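(* Let $q$ be a prime power and let $v,k,d,m$ be integers with $2\le k\le v$, $d$ even, $2\le d\le 2k$, and $k\le m\le v-k$. Then $$A_q(v,d;k)\ge A_q(m,d;k)\cdot \left\lceil q^{(v-m)(k-d/2+1)}\right\rceil+B_q(v,v-m,d;k).$$
   Context: For a prime power $q$ and a finite-dimensional vector space $V$ over $\mathbb{F}_q$, the subspace distance between subspaces $U,W$ of $V$ is $\mathrm{d}_{\mathrm{s}}(U,W)=\dim(U+W)-\dim(U\cap W)$. $A_q(v,d;k)$ denotes the maximum number of $k$-dimensional subspaces of $\mathbb{F}_q^v$ with pairwise subspace distance at least $d$ (a constant dimension code). For integers $0\le v_2\le v_1$, $B_q(v_1,v_2,d;k)$ denotes the maximum number of $k$-dimensional subspaces of $\mathbb{F}_q^{v_1}$ with pairwise subspace distance at least $d$ such that there exists a $v_2$-dimensional subspace $W$ of $\mathbb{F}_q^{v_1}$ intersecting every chosen $k$-space in a subspace of dimension at least $d/2$. *)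

theory Defs
  imports Complex_Main "HOL-Library.Function_Algebras" "HOL-Library.FuncSet" "HOL-Library.Cardinality"
begin

text \<open>
  The field with \<open>q\<close> elements is a type \<open>'a :: {finite, field}\<close> with \<open>CARD('a) = q\<close>.  So that the
  dimension \<open>n\<close> is an ordinary natural number, \<open>'a\<^sup>n\<close> is realised inside the vector space
  \<open>nat \<Rightarrow> 'a\<close> as the functions vanishing at all indices \<open>i \<ge> n\<close>.
\<close>

definition scale_fun :: "'a::field \<Rightarrow> (nat \<Rightarrow> 'a) \<Rightarrow> nat \<Rightarrow> 'a"
  where "scale_fun c x = (\<lambda>i. c * x i)"

global_interpretation fvec: vector_space "scale_fun :: 'a::field \<Rightarrow> (nat \<Rightarrow> 'a) \<Rightarrow> nat \<Rightarrow> 'a"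
  by unfold_locales (auto simp: scale_fun_def fun_eq_iff algebra_simps)

definition coord_space :: "nat \<Rightarrow> (nat \<Rightarrow> 'a::field) set"
  where "coord_space n = {x. \<forall>i\<ge>n. x i = 0}"

definition subspaces_of_dim :: "nat \<Rightarrow> nat \<Rightarrow> (nat \<Rightarrow> 'a::field) set set"
  where "subspaces_of_dim n k =
    {U. fvec.subspace U \<and> U \<subseteq> coord_space n \<and> fvec.dim U = k}"

definition subspace_dist :: "(nat \<Rightarrow> 'a::field) set \<Rightarrow> (nat \<Rightarrow> 'a) set \<Rightarrow> int"
  where "subspace_dist U W =
    int (fvec.dim {u + w | u w. u \<in> U \<and> w \<in> W}) - int (fvec.dim (U \<inter> W))"

definition constant_dim_code :: "nat \<Rightarrow> nat \<Rightarrow> nat \<Rightarrow> (nat \<Rightarrow> 'a::field) set set \<Rightarrow> bool"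
  where "constant_dim_code n d k C \<longleftrightarrow>
    C \<subseteq> subspaces_of_dim n k \<and> pairwise (\<lambda>U W. int d \<le> subspace_dist U W) C"

text \<open>
  The argument \<open>F\<close> only supplies the field.  The maxima are over finite sets of numbers by
  \<open>finite_constant_dim_codes\<close>.  They contain \<open>0\<close>, from the empty code; for \<open>B_max\<close> this needs
  \<open>v2 \<le> v1\<close>, when \<open>coord_space v2\<close> can serve as \<open>W\<close>.
\<close>

definition A_max :: "'a::{finite,field} itself \<Rightarrow> nat \<Rightarrow> nat \<Rightarrow> nat \<Rightarrow> nat"
  where "A_max F v d k =
    Max {card C | C :: (nat \<Rightarrow> 'a) set set. constant_dim_code v d k C}"

definition B_max :: "'a::{finite,field} itself \<Rightarrow> nat \<Rightarrow> nat \<Rightarrow> nat \<Rightarrow> nat \<Rightarrow> nat"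
  where "B_max F v1 v2 d k =
    Max {card C | C :: (nat \<Rightarrow> 'a) set set. constant_dim_code v1 d k C \<and>
      (\<exists>W \<in> subspaces_of_dim v1 v2. \<forall>U\<in>C. real d / 2 \<le> real (fvec.dim (U \<inter> W)))}"

lemma finite_coord_space: "finite (coord_space n :: (nat \<Rightarrow> 'a::{finite,field}) set)"
proof -
  have "coord_space n \<subseteq> (\<lambda>f i. if i < n then f i else 0) ` ({..<n} \<rightarrow>\<^sub>E (UNIV :: 'a set))"
  proof
    fix x :: "nat \<Rightarrow> 'a" assume "x \<in> coord_space n"
    then have "x = (\<lambda>i. if i < n then restrict x {..<n} i else 0)"
      by (auto simp: coord_space_def fun_eq_iff)
    then show "x \<in> (\<lambda>f i. if i < n then f i else 0) ` ({..<n} \<rightarrow>\<^sub>E UNIV)"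
      by (intro image_eqI[where x = "restrict x {..<n}"]) auto
  qed
  then show ?thesis
    by (rule finite_subset) (intro finite_imageI finite_PiE; simp)
qed

lemma finite_constant_dim_codes:
  "finite {C :: (nat \<Rightarrow> 'a::{finite,field}) set set. constant_dim_code n d k C}"
  by (rule finite_subset[of _ "Pow (Pow (coord_space n))"])
    (auto simp: constant_dim_code_def subspaces_of_dim_def finite_coord_space)

lemma dim_coord_space: "fvec.dim (coord_space n :: (nat \<Rightarrow> 'a::field) set) = n"
proof -
  define e :: "nat \<Rightarrow> nat \<Rightarrow> 'a" where "e i = (\<lambda>j. if j = i then 1 else 0)" for i
  have app: "(\<Sum>i\<in>A. scale_fun (c i) (e i)) j = (\<Sum>i\<in>A. if j = i then c i else 0)"
    if "finite A" for A c j
    using that by (induction A rule: finite_induct) (auto simp: scale_fun_def e_def)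
  have inj: "inj_on e {..<n}"
    by (auto simp: inj_on_def e_def fun_eq_iff split: if_splits)
  have "fvec.independent (e ` {..<n})"
  proof (rule fvec.independent_if_scalars_zero)
    show "finite (e ` {..<n})" by simp
    fix f x assume s: "(\<Sum>x\<in>e ` {..<n}. scale_fun (f x) x) = 0" and "x \<in> e ` {..<n}"
    then obtain i where i: "i < n" "x = e i" by auto
    have "(\<Sum>j<n. scale_fun (f (e j)) (e j)) = 0"
      using s by (simp add: sum.reindex[OF inj])
    then have "(\<Sum>j<n. scale_fun (f (e j)) (e j)) i = 0" by simp
    then show "f x = 0" using i by (simp add: app)
  qed
  moreover have "e ` {..<n} \<subseteq> coord_space n"
    by (auto simp: e_def coord_space_def)
  moreover have "coord_space n \<subseteq> fvec.span (e ` {..<n})"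
  proof
    fix x :: "nat \<Rightarrow> 'a" assume "x \<in> coord_space n"
    then have "x = (\<Sum>i<n. scale_fun (x i) (e i))"
      by (auto simp: fun_eq_iff app coord_space_def)
    also have "\<dots> \<in> fvec.span (e ` {..<n})"
      by (intro fvec.span_sum fvec.span_scale fvec.span_base) auto
    finally show "x \<in> fvec.span (e ` {..<n})" .
  qed
  ultimately have "fvec.dim (coord_space n :: (nat \<Rightarrow> 'a) set) = card (e ` {..<n})"
    by (metis fvec.basis_card_eq_dim)
  then show ?thesis by (simp add: card_image[OF inj])
qed

lemma coord_space_in_subspaces_of_dim:
  "n \<le> v \<Longrightarrow> coord_space n \<in> subspaces_of_dim v n"
  by (auto simp: subspaces_of_dim_def dim_coord_space fvec.subspace_def)
    (auto simp: coord_space_def scale_fun_def)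

end

theory Submission
  imports Defs "HOL-Algebra.Algebraic_Closure_Type"
begin

text \<open>
  Write \<open>n = v - m\<close> and \<open>\<delta> = d / 2\<close>.  Linearized polynomials \<open>\<Sum>i\<le>k-\<delta>. a\<^sub>i x^(q^i)\<close> with
  coefficients in the field with \<open>q^n\<close> elements are linear over the field with \<open>q\<close> elements, and two
  of them agree in at most \<open>q^(k-\<delta>)\<close> points.  This gives \<open>q^(n(k-\<delta>+1))\<close> linear maps on a space of
  dimension \<open>n \<ge> k\<close>.  Let \<open>W\<close> be the \<open>n\<close>-dimensional space of an optimal code for \<open>B\<close>.
  Place an optimal code for \<open>A(m, d; k)\<close> in a complement of \<open>W\<close> and replace each codeword \<open>U\<close> by the
  graphs of these maps, regarded as maps from \<open>U\<close> to \<open>W\<close>.  Graphs over different codewords meet in a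
  space no larger than the codewords do; graphs over the same codeword meet where the maps agree;
  and all graphs meet \<open>W\<close> trivially, so they meet a \<open>k\<close>-space that contains \<open>\<delta>\<close> dimensions of \<open>W\<close> in
  dimension at most \<open>k - \<delta>\<close>.
\<close>

section \<open>Cardinalities of subspaces over a finite field\<close>

context vector_space
begin

text \<open>Adjoining \<open>b\<close> outside \<open>span B\<close> makes
  \<open>(c, x) \<mapsto> scale c b + x\<close> a bijection from scalars times \<open>span B\<close>
  onto the new span, so each basis vector contributes a factor \<open>CARD('a)\<close>.\<close>

lemma card_span_independent:
  assumes "finite (UNIV :: 'a set)" "finite B" "independent B"
  shows "finite (span B) \<and> card (span B) = CARD('a) ^ card B"
  using assms(2,3)
proof (induction B rule: finite_induct)
  case empty
  then show ?case by simp
next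
  case (insert b B)
  have b: "b \<notin> span B" and B: "independent B"
    using insert by (auto simp: independent_insert)
  then have IH: "finite (span B)" "card (span B) = CARD('a) ^ card B"
    using insert.IH by auto
  let ?f = "\<lambda>(c, x). scale c b + x"
  have "inj_on ?f (UNIV \<times> span B)"
  proof (rule inj_onI, clarify)
    fix c x c' x'
    assume x: "x \<in> span B" "x' \<in> span B" and eq: "scale c b + x = scale c' b + x'"
    then have "scale (c - c') b = x' - x"
      by (simp add: scale_left_diff_distrib algebra_simps)
    then have "scale (c - c') b \<in> span B"
      using x by (simp add: span_diff)
    then have "c = c'"
      using b span_scale[of "scale (c - c') b" B "inverse (c - c')"] by (cases "c - c' = 0") auto
    then show "c = c' \<and> x = x'"
      using eq by simp
  qed
  moreover have "span (insert b B) = ?f ` (UNIV \<times> span B)"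
  proof (intro subset_antisym subsetI)
    fix x assume "x \<in> span (insert b B)"
    then obtain c where "x - scale c b \<in> span B"
      by (auto simp: span_insert)
    then show "x \<in> ?f ` (UNIV \<times> span B)"
      by (intro image_eqI[of _ _ "(c, x - scale c b)"]) auto
  next
    fix x assume "x \<in> ?f ` (UNIV \<times> span B)"
    then obtain c y where "y \<in> span B" "x = scale c b + y" by auto
    then show "x \<in> span (insert b B)"
      by (auto simp: span_insert intro!: exI[of _ c])
  qed
  ultimately show ?case
    using IH insert.hyps assms(1) by (simp add: card_image card_cartesian_product)
qed

text \<open>Over a finite field dimension and cardinality determine each other; dimension estimates
  below are therefore proved by counting.\<close>

lemma card_subspace:
  assumes "finite (UNIV :: 'a set)" "subspace S" "finite S"
  shows "card S = CARD('a) ^ dim S"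
proof -
  obtain B where B: "B \<subseteq> S" "independent B" "S \<subseteq> span B" "card B = dim S"
    using basis_exists by blast
  then have "span B = S"
    using assms(2) by (simp add: span_subspace)
  then show ?thesis
    using card_span_independent[OF assms(1) finite_subset[OF B(1) assms(3)] B(2)] B(4) by simp
qed

text \<open>The dimension formula in multiplicative form: every fibre of addition on
  \<open>S \<times> T\<close> is a translate of the pairs \<open>(w, - w)\<close> with
  \<open>w\<close> in \<open>S \<inter> T\<close>.\<close>

lemma card_sums_Int:
  assumes "finite S" "finite T" "subspace S" "subspace T"
  shows "card {x + y |x y. x \<in> S \<and> y \<in> T} * card (S \<inter> T) = card S * card T"
proof -
  let ?f = "\<lambda>(x, y). x + y" and ?R = "{x + y |x y. x \<in> S \<and> y \<in> T}"
  have fib: "card {p \<in> S \<times> T. ?f p = z} = card (S \<inter> T)" if "z \<in> ?R" for z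
  proof -
    from that obtain x y where xy: "x \<in> S" "y \<in> T" "z = x + y" by blast
    have "bij_betw (\<lambda>w. (x + w, y - w)) (S \<inter> T) {p \<in> S \<times> T. ?f p = z}"
    proof (rule bij_betwI[where g = "\<lambda>p. fst p - x"])
      show "(\<lambda>w. (x + w, y - w)) \<in> S \<inter> T \<rightarrow> {p \<in> S \<times> T. ?f p = z}"
        using xy assms by (auto intro: subspace_add subspace_diff)
      show "(\<lambda>p. fst p - x) \<in> {p \<in> S \<times> T. ?f p = z} \<rightarrow> S \<inter> T"
      proof
        fix p assume p: "p \<in> {p \<in> S \<times> T. ?f p = z}"
        then have "fst p + snd p = x + y"
          using xy by auto
        then have "fst p - x = y - snd p"
          by (simp add: algebra_simps)
        moreover have "fst p - x \<in> S" "y - snd p \<in> T"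
          using p xy assms by (auto intro: subspace_diff)
        ultimately show "fst p - x \<in> S \<inter> T"
          by simp
      qed
    qed (use xy in \<open>auto simp: algebra_simps\<close>)
    then show ?thesis by (simp add: bij_betw_same_card)
  qed
  have R: "?R = ?f ` (S \<times> T)" by auto
  have "card (S \<times> T) = (\<Sum>z\<in>?R. card {p \<in> S \<times> T. ?f p = z})"
    unfolding R using assms(1,2) sum.image_gen[of "S \<times> T" "\<lambda>_. 1 :: nat" ?f] by simp
  also have "\<dots> = card ?R * card (S \<inter> T)"
    using fib by simp
  finally show ?thesis
    by (simp add: card_cartesian_product)
qed

end

section \<open>Powers of the Frobenius map\<close>

text \<open>Multiplication by a nonzero \<open>x\<close> permutes the nonzero elements; comparing
  their products before and after gives \<open>x ^ (q - 1) = 1\<close>.\<close>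

lemma finite_field_power_CARD:
  fixes x :: "'a::{finite,field}"
  shows "x ^ CARD('a) = x"
proof (cases "x = 0")
  case False
  let ?U = "UNIV - {0 :: 'a}"
  have "(\<Prod>y\<in>?U. y) = (\<Prod>y\<in>?U. x * y)"
    by (rule prod.reindex_bij_witness[of _ "\<lambda>y. x * y" "\<lambda>y. y / x"]) (use False in auto)
  also have "\<dots> = x ^ card ?U * (\<Prod>y\<in>?U. y)"
    by (simp add: prod.distrib)
  finally have "x ^ card ?U = 1"
    by simp
  moreover have "CARD('a) = Suc (card ?U)"
    by (simp add: card_Suc_Diff1)
  ultimately show ?thesis
    by (simp only: power_Suc mult_1_right)
qed (simp add: zero_power)

text \<open>
  The polynomial \<open>(x + 1)^q - x^q - 1\<close> has degree below \<open>q\<close> and vanishes at all \<open>q\<close> elements of the field.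
  This makes \<open>x \<mapsto> x^q\<close> additive without first showing that \<open>q\<close> is a power of the characteristic.
\<close>

lemma of_nat_CARD_choose_eq_0:
  assumes "0 < i" "i < CARD('a::{finite,field})"
  shows "of_nat (CARD('a) choose i) = (0 :: 'a)"
proof -
  let ?q = "CARD('a)"
  define p :: "'a poly" where "p = (\<Sum>j\<in>{0<..<?q}. monom (of_nat (?q choose j)) j)"
  have "poly p x = 0" for x
  proof -
    have "{..?q} = insert 0 (insert ?q {0<..<?q})"
      by auto
    then have "(x + 1) ^ ?q = 1 + (x ^ ?q + poly p x)"
      by (simp add: binomial_ring p_def poly_sum poly_monom)
    then show ?thesis
      by (simp add: finite_field_power_CARD)
  qed
  moreover have "degree p < ?q"
    unfolding p_def using assms
    by (intro degree_sum_less) (auto intro: le_less_trans[OF degree_monom_le])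
  ultimately have "p = 0"
    using assms by (intro poly_eqI_degree[of UNIV]) auto
  then have "coeff p i = 0" by simp
  then show ?thesis
    using assms by (simp add: p_def coeff_sum)
qed

lemma CARD_field_ge_2: "2 \<le> CARD('a::{finite,field})"
proof -
  have "card {0, 1 :: 'a} \<le> CARD('a)"
    by (intro card_mono) auto
  then show ?thesis by simp
qed

text \<open>The inner binomial coefficients vanish in the base field, hence also in its closure,
  because \<open>to_ac\<close> commutes with \<open>of_nat\<close>. Iterating the case of exponent q
  gives all powers of the Frobenius map.\<close>

lemma alg_closure_power_CARD_add:
  fixes x y :: "'a::{finite,field} alg_closure"
  shows "(x + y) ^ CARD('a) ^ i = x ^ CARD('a) ^ i + y ^ CARD('a) ^ i"
proof (induction i arbitrary: x y)
  case (Suc i)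
  let ?q = "CARD('a)"
  have q: "(x + y) ^ ?q = x ^ ?q + y ^ ?q" for x y :: "'a alg_closure"
  proof -
    have 0: "of_nat (?q choose j) = (0 :: 'a alg_closure)" if "j \<in> {0<..<?q}" for j
      using of_nat_CARD_choose_eq_0[of j, where 'a = 'a] that by (metis greaterThanLessThan_iff to_ac_0 to_ac_of_nat)
    have "{..?q} = insert 0 (insert ?q {0<..<?q})"
      by auto
    then show ?thesis
      by (simp add: binomial_ring 0)
  qed
  show ?case
    by (simp add: power_mult q Suc)
qed simp

lemma to_ac_power_CARD:
  fixes c :: "'a::{finite,field}"
  shows "to_ac c ^ CARD('a) ^ i = to_ac c"
  by (induction i) (simp_all add: power_mult finite_field_power_CARD flip: to_ac_power)

text \<open>The polynomial \<open>X ^ (q ^ n) - X\<close> splits over the algebraic closure and has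
  derivative -1, so it has as many distinct roots as its degree. For \<open>n = 0\<close> it would
  be the zero polynomial.\<close>

lemma card_alg_closure_power_fixed:
  assumes "0 < n"
  shows "card {x :: 'a::{finite,field} alg_closure. x ^ CARD('a) ^ n = x} = CARD('a) ^ n"
proof -
  let ?q = "CARD('a)"
  let ?N = "?q ^ n"
  define p :: "'a alg_closure poly" where "p = monom 1 ?N - monom 1 1"
  have N: "2 \<le> ?N"
    using CARD_field_ge_2[where 'a = 'a] assms
    by (metis One_nat_def Suc_leI le_trans numeral_2_eq_2 one_le_numeral power_increasing power_one_right)
  \<comment> \<open>The binomial coefficient with lower index 1 is q itself.\<close>
  have "(of_nat ?q :: 'a) = 0"
    using of_nat_CARD_choose_eq_0[of 1, where 'a = 'a] CARD_field_ge_2[where 'a = 'a] by simp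
  then have "(of_nat ?q :: 'a alg_closure) = 0"
    by (metis to_ac_0 to_ac_of_nat)
  then have N0: "(of_nat ?N :: 'a alg_closure) = 0"
    using assms by simp
  have deg: "degree p = ?N"
    using N unfolding p_def diff_conv_add_uminus
    by (subst degree_add_eq_left) (auto simp: degree_monom_eq)
  have p0: "p \<noteq> 0"
    using deg N by auto
  have dp: "pderiv p = - 1"
    using N0 by (simp add: p_def pderiv_diff pderiv_monom)
  \<comment> \<open>A multiple root would also be a root of the derivative, which is the constant
    -1.\<close>
  have ord: "order x p \<le> 1" for x
  proof (rule ccontr)
    assume "\<not> order x p \<le> 1"
    then have "[:-x, 1:] ^ 2 dvd p"
      by (simp add: order_divides p0)
    then obtain r where "p = [:-x, 1:] * ([:-x, 1:] * r)"
      by (auto simp only: power2_eq_square mult.assoc elim!: dvdE)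
    then have "poly (pderiv p) x = 0"
      by (simp only: pderiv_mult poly_add poly_mult) simp
    then show False by (simp add: dp)
  qed
  obtain A where A: "size A = degree p" "p = smult (lead_coeff p) (\<Prod>x\<in>#A. [:-x, 1:])"
    using alg_closed_imp_factorization[OF p0] by blast
  have "proots p = proots (\<Prod>x\<in>#A. [:-x, 1:])"
    using p0 by (subst A(2)) simp
  also have "\<dots> = A"
  proof (induction A)
    case (add x A)
    have "(\<Prod>x\<in>#A. [:-x, 1:]) \<noteq> 0"
      by (auto simp: prod_mset_zero_iff)
    then have "proots ([:-x, 1:] * (\<Prod>x\<in>#A. [:-x, 1:])) = {#x#} + A"
      by (subst proots_mult) (auto simp: add.IH)
    then show ?case
      by simp
  qed simp
  finally have "size (proots p) = ?N"
    using A deg by simp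
  moreover have "size (proots p) = card (set_mset (proots p))"
  proof -
    have "count (proots p) x = 1" if "x \<in># proots p" for x
      using ord[of x] that p0 by (metis One_nat_def Suc_leI count_greater_zero_iff count_proots le_antisym)
    then show ?thesis
      by (simp add: size_multiset_overloaded_eq)
  qed
  moreover have "set_mset (proots p) = {x. x ^ ?N = x}"
    using p0 by (auto simp: p_def poly_monom)
  ultimately show ?thesis by simp
qed

section \<open>Gabidulin codes\<close>

text \<open>Extends a bijection of bases. Stated for a pair of spaces so that it covers maps between
  coordinate spaces and maps to and from the algebraic closure.\<close>

lemma (in vector_space_pair) finite_subspaces_isomorphism:
  assumes "finite S" "finite T" "vs1.subspace S" "vs2.subspace T" "vs1.dim S = vs2.dim T"
  obtains f where "Vector_Spaces.linear s1 s2 f" "inj_on f S" "f ` S = T"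
proof -
  obtain B where "B \<subseteq> S" "vs1.independent B" "S \<subseteq> vs1.span B" "card B = vs1.dim S"
    using vs1.basis_exists by blast
  moreover obtain C where "C \<subseteq> T" "vs2.independent C" "T \<subseteq> vs2.span C" "card C = vs2.dim T"
    using vs2.basis_exists by blast
  ultimately show thesis
    using finite_basis_to_basis_subspace_isomorphism[OF assms(3-5)] that assms(1,2)
    by (metis finite_subset)
qed

section \<open>The field with q^n elements as a vector space over its subfield with q
  elements\<close>

definition ac_scale :: "'a::field \<Rightarrow> 'a alg_closure \<Rightarrow> 'a alg_closure"
  where "ac_scale c x = to_ac c * x"

interpretation acvec: vector_space ac_scale
  by unfold_locales (auto simp: ac_scale_def algebra_simps)

interpretation fvec_ac: vector_space_pair scale_fun ac_scale ..

interpretation ac_fvec: vector_space_pair ac_scale scale_fun ..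

interpretation fvec_fvec: vector_space_pair scale_fun scale_fun ..

lemma subspace_coord_space: "fvec.subspace (coord_space n)"
  by (auto simp: fvec.subspace_def coord_space_def scale_fun_def)

lemma card_coord_space: "card (coord_space n :: (nat \<Rightarrow> 'a::{finite,field}) set) = CARD('a) ^ n"
  using fvec.card_subspace[OF _ subspace_coord_space finite_coord_space] by (simp add: dim_coord_space)

text \<open>For \<open>n > 0\<close>, the field with q^n elements. Since \<open>n\<close> is a
  variable of the theorem, it is a subset of the closure and not a type.\<close>

definition ac_subfield :: "nat \<Rightarrow> 'a::{finite,field} alg_closure set"
  where "ac_subfield n = {x. x ^ CARD('a) ^ n = x}"

lemma card_ac_subfield:
  "0 < n \<Longrightarrow> card (ac_subfield n :: 'a::{finite,field} alg_closure set) = CARD('a) ^ n"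
  unfolding ac_subfield_def by (rule card_alg_closure_power_fixed)

lemma finite_ac_subfield:
  "0 < n \<Longrightarrow> finite (ac_subfield n :: 'a::{finite,field} alg_closure set)"
  by (rule card_ge_0_finite) (simp add: card_ac_subfield)

lemma ac_subfield_add: "x \<in> ac_subfield n \<Longrightarrow> y \<in> ac_subfield n \<Longrightarrow> x + y \<in> ac_subfield n"
  by (simp add: ac_subfield_def alg_closure_power_CARD_add)

lemma ac_subfield_mult: "x \<in> ac_subfield n \<Longrightarrow> y \<in> ac_subfield n \<Longrightarrow> x * y \<in> ac_subfield n"
  by (simp add: ac_subfield_def power_mult_distrib)

lemma ac_subfield_power: "x \<in> ac_subfield n \<Longrightarrow> x ^ i \<in> ac_subfield n"
  by (simp add: ac_subfield_def) (metis mult.commute power_mult)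

lemma ac_subfield_0: "0 \<in> ac_subfield n"
  by (simp add: ac_subfield_def)

lemma subspace_ac_subfield: "acvec.subspace (ac_subfield n)"
  unfolding acvec.subspace_def
  by (auto simp: ac_subfield_0 ac_subfield_add)
    (simp add: ac_subfield_def ac_scale_def power_mult_distrib to_ac_power_CARD)

lemma dim_ac_subfield:
  assumes "0 < n"
  shows "acvec.dim (ac_subfield n :: 'a::{finite,field} alg_closure set) = n"
proof -
  have "CARD('a) ^ acvec.dim (ac_subfield n :: 'a alg_closure set) = CARD('a) ^ n"
    using acvec.card_subspace[OF _ subspace_ac_subfield finite_ac_subfield[OF assms], where 'a1 = 'a]
    by (simp add: card_ac_subfield assms)
  then show ?thesis
    using CARD_field_ge_2[where 'a = 'a] by (subst (asm) power_inject_exp) auto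
qed

section \<open>Linearized polynomials\<close>

definition linearized_poly :: "nat \<Rightarrow> (nat \<Rightarrow> 'a::{finite,field} alg_closure) \<Rightarrow> 'a alg_closure \<Rightarrow> 'a alg_closure"
  where "linearized_poly r a x = (\<Sum>i\<le>r. a i * x ^ CARD('a) ^ i)"

text \<open>Powers of the Frobenius map are additive and fix the scalars
  \<open>to_ac c\<close>.\<close>

lemma linear_linearized_poly: "Vector_Spaces.linear ac_scale ac_scale (linearized_poly r a)"
  by (simp add: Vector_Spaces.linear_iff acvec.vector_space_axioms linearized_poly_def
      alg_closure_power_CARD_add distrib_left sum.distrib ac_scale_def power_mult_distrib
      to_ac_power_CARD sum_distrib_left mult.left_commute)

lemma linearized_poly_in_ac_subfield:
  assumes "\<And>i. i \<le> r \<Longrightarrow> a i \<in> ac_subfield n" "x \<in> ac_subfield n"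
  shows "linearized_poly r a x \<in> ac_subfield n"
proof -
  have "(\<Sum>i\<in>I. a i * x ^ CARD('a) ^ i) \<in> ac_subfield n" if "finite I" "I \<subseteq> {..r}" for I
    using that
    by (induction I rule: finite_induct)
      (auto simp: ac_subfield_0 intro!: ac_subfield_add ac_subfield_mult ac_subfield_power assms)
  then show ?thesis
    by (simp add: linearized_poly_def)
qed

text \<open>The difference is a polynomial of ordinary degree at most \<open>q ^ r\<close>. It is
  nonzero because distinct indices give distinct exponents \<open>q ^ i\<close>, so the coefficients
  \<open>a i - b i\<close> do not mix.\<close>

lemma card_linearized_poly_agree:
  fixes a b :: "nat \<Rightarrow> 'a::{finite,field} alg_closure"
  assumes "i \<le> r" "a i \<noteq> b i"
  shows "finite {x. linearized_poly r a x = linearized_poly r b x}"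
    and "card {x. linearized_poly r a x = linearized_poly r b x} \<le> CARD('a) ^ r"
proof -
  let ?q = "CARD('a)"
  define p where "p = (\<Sum>i\<le>r. monom (a i - b i) (?q ^ i))"
  have inj: "?q ^ i = ?q ^ j \<longleftrightarrow> i = j" for i j
    using CARD_field_ge_2[where 'a = 'a] by (intro power_inject_exp) auto
  have "coeff p (?q ^ i) = a i - b i"
    using assms(1) by (simp add: p_def coeff_sum inj if_distrib cong: if_cong)
  then have "p \<noteq> 0"
    using assms(2) by auto
  moreover have "degree p \<le> ?q ^ r"
    unfolding p_def using CARD_field_ge_2[where 'a = 'a]
    by (intro degree_sum_le) (auto intro!: order_trans[OF degree_monom_le] power_increasing)
  moreover have "{x. linearized_poly r a x = linearized_poly r b x} = {x. poly p x = 0}"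
    by (simp add: p_def linearized_poly_def poly_sum poly_monom left_diff_distrib sum_subtractf)
  ultimately show "finite {x. linearized_poly r a x = linearized_poly r b x}"
    and "card {x. linearized_poly r a x = linearized_poly r b x} \<le> ?q ^ r"
    using card_poly_roots_bound[of p] poly_roots_finite[of p] by auto
qed

text \<open>A maximum rank distance code: there are \<open>q ^ n\<close> choices for each of
  \<open>r + 1\<close> coefficients, and isomorphisms with \<open>ac_subfield n\<close> transport
  the maps to \<open>coord_space n\<close>. The functions are total, but only their values on
  \<open>coord_space n\<close> are compared.\<close>

lemma gabidulin_code:
  assumes "r < n"
  obtains \<Phi> :: "((nat \<Rightarrow> 'a::{finite,field}) \<Rightarrow> nat \<Rightarrow> 'a) set"
  where "finite \<Phi>" "card \<Phi> = CARD('a) ^ (n * (r + 1))"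
    "\<And>f. f \<in> \<Phi> \<Longrightarrow> Vector_Spaces.linear scale_fun scale_fun f"
    "\<And>f. f \<in> \<Phi> \<Longrightarrow> f ` coord_space n \<subseteq> coord_space n"
    "\<And>f g. f \<in> \<Phi> \<Longrightarrow> g \<in> \<Phi> \<Longrightarrow> f \<noteq> g \<Longrightarrow> card {x \<in> coord_space n. f x = g x} \<le> CARD('a) ^ r"
proof -
  let ?q = "CARD('a)" and ?V = "coord_space n :: (nat \<Rightarrow> 'a) set"
  let ?E = "ac_subfield n :: 'a alg_closure set"
  have n: "0 < n" using assms by simp
  note E = finite_ac_subfield[OF n] subspace_ac_subfield[of n] dim_ac_subfield[OF n]
  note V = finite_coord_space[of n] subspace_coord_space[of n] dim_coord_space[of n]
  obtain \<theta> where \<theta>: "Vector_Spaces.linear scale_fun ac_scale \<theta>" "inj_on \<theta> ?V" "\<theta> ` ?V = ?E"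
    using fvec_ac.finite_subspaces_isomorphism[OF V(1) E(1) V(2) E(2)] V(3) E(3) by metis
  obtain \<eta> where \<eta>: "Vector_Spaces.linear ac_scale scale_fun \<eta>" "inj_on \<eta> ?E" "\<eta> ` ?E = ?V"
    using ac_fvec.finite_subspaces_isomorphism[OF E(1) V(1) E(2) V(2)] V(3) E(3) by metis
  define \<phi> where "\<phi> a = \<eta> \<circ> linearized_poly r a \<circ> \<theta>" for a
  let ?I = "{..r} \<rightarrow>\<^sub>E ?E"
  \<comment> \<open>Injectivity of \<open>\<eta>\<close> reduces agreement of values to agreement of
    the polynomials, and injectivity of \<open>\<theta>\<close> preserves the count of
    points.\<close>
  have agree: "card {x \<in> ?V. \<phi> a x = \<phi> b x} \<le> ?q ^ r" if ab: "a \<in> ?I" "b \<in> ?I" "a \<noteq> b" for a b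
  proof -
    obtain i where i: "i \<le> r" "a i \<noteq> b i"
      using ab by (metis PiE_ext atMost_iff)
    have "\<theta> ` {x \<in> ?V. \<phi> a x = \<phi> b x} \<subseteq> {x. linearized_poly r a x = linearized_poly r b x}"
    proof (clarsimp simp: \<phi>_def)
      fix x assume "x \<in> ?V" "\<eta> (linearized_poly r a (\<theta> x)) = \<eta> (linearized_poly r b (\<theta> x))"
      moreover have "linearized_poly r c (\<theta> x) \<in> ?E" if "c \<in> ?I" for c
        using that \<theta>(3) \<open>x \<in> ?V\<close> by (intro linearized_poly_in_ac_subfield) auto
      ultimately show "linearized_poly r a (\<theta> x) = linearized_poly r b (\<theta> x)"
        using ab \<eta>(2) by (meson inj_onD)
    qed
    then have "card (\<theta> ` {x \<in> ?V. \<phi> a x = \<phi> b x}) \<le> ?q ^ r"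
      using card_linearized_poly_agree[of i r a b, OF i] by (meson card_mono le_trans)
    moreover have "inj_on \<theta> {x \<in> ?V. \<phi> a x = \<phi> b x}"
      using \<theta>(2) by (rule inj_on_subset) auto
    ultimately show ?thesis
      by (simp add: card_image)
  qed
  \<comment> \<open>Equal maps would agree on all \<open>q ^ n\<close> points, too many because
    \<open>r < n\<close>.\<close>
  have inj: "inj_on \<phi> ?I"
  proof (rule inj_onI, rule ccontr)
    fix a b assume "a \<in> ?I" "b \<in> ?I" "\<phi> a = \<phi> b" "a \<noteq> b"
    then have "card ?V \<le> ?q ^ r"
      using agree[of a b] by simp
    then show False
      using assms CARD_field_ge_2[where 'a = 'a]
      by (simp add: card_coord_space not_le power_strict_increasing)
  qed
  show thesis
  proof (rule that[of "\<phi> ` ?I"])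
    show "finite (\<phi> ` ?I)"
      using E(1) by (intro finite_imageI finite_PiE) auto
    show "card (\<phi> ` ?I) = ?q ^ (n * (r + 1))"
      using inj by (simp add: card_image card_PiE card_ac_subfield n power_add power_mult)
    show "Vector_Spaces.linear scale_fun scale_fun f" if "f \<in> \<phi> ` ?I" for f
      using that \<theta>(1) \<eta>(1)
      by (auto simp: \<phi>_def intro!: Vector_Spaces.linear_compose[of _ ac_scale] linear_linearized_poly)
    show "f ` ?V \<subseteq> ?V" if "f \<in> \<phi> ` ?I" for f
    proof -
      from that obtain a where "a \<in> ?I" "f = \<phi> a" by blast
      then show ?thesis
        using \<theta>(3) \<eta>(3) linearized_poly_in_ac_subfield[of r a n]
        by (auto simp: \<phi>_def PiE_iff)
    qed
    show "card {x \<in> ?V. f x = g x} \<le> ?q ^ r" if "f \<in> \<phi> ` ?I" "g \<in> \<phi> ` ?I" "f \<noteq> g" for f g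
      using that agree by auto
  qed
qed

section \<open>Lifting a constant dimension code\<close>

lemma card_subspaces_of_dim:
  fixes U :: "(nat \<Rightarrow> 'a::{finite,field}) set"
  assumes "U \<in> subspaces_of_dim v k"
  shows "finite U" "card U = CARD('a) ^ k"
proof -
  show "finite U"
    using assms finite_subset[OF _ finite_coord_space] by (auto simp: subspaces_of_dim_def)
  then show "card U = CARD('a) ^ k"
    using assms fvec.card_subspace[of U] by (auto simp: subspaces_of_dim_def)
qed

lemma subspaces_of_dimI:
  fixes U :: "(nat \<Rightarrow> 'a::{finite,field}) set"
  assumes "fvec.subspace U" "U \<subseteq> coord_space v" "card U = CARD('a) ^ k"
  shows "U \<in> subspaces_of_dim v k"
proof -
  have "finite U"
    using assms(2) finite_coord_space by (rule finite_subset)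
  then have "CARD('a) ^ fvec.dim U = CARD('a) ^ k"
    using fvec.card_subspace[OF _ assms(1)] assms(3) by simp
  then have "fvec.dim U = k"
    using CARD_field_ge_2[where 'a = 'a] by (subst (asm) power_inject_exp) auto
  then show ?thesis
    using assms by (simp add: subspaces_of_dim_def)
qed

text \<open>By the dimension formula the distance is \<open>2 * k - 2 * dim (U \<inter> W)\<close>.
  The product form of the bound avoids the truncated subtraction
  \<open>k - \<delta>\<close>.\<close>

lemma subspace_dist_ge_iff:
  fixes U W :: "(nat \<Rightarrow> 'a::{finite,field}) set"
  assumes "U \<in> subspaces_of_dim v k" "W \<in> subspaces_of_dim v k"
  shows "int (2 * \<delta>) \<le> subspace_dist U W \<longleftrightarrow> card (U \<inter> W) * CARD('a) ^ \<delta> \<le> CARD('a) ^ k"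
proof -
  let ?q = "CARD('a)" and ?S = "{u + w |u w. u \<in> U \<and> w \<in> W}"
  have q: "1 < ?q"
    using CARD_field_ge_2[where 'a = 'a] by simp
  note fin = card_subspaces_of_dim(1)[OF assms(1)] card_subspaces_of_dim(1)[OF assms(2)]
  have sub: "fvec.subspace U" "fvec.subspace W"
    using assms by (auto simp: subspaces_of_dim_def)
  have int: "card (U \<inter> W) = ?q ^ fvec.dim (U \<inter> W)"
    using fin by (intro fvec.card_subspace fvec.subspace_inter sub) auto
  have "?S = (\<lambda>(u, w). u + w) ` (U \<times> W)"
    by auto
  then have "finite ?S"
    using fin by simp
  then have "card ?S = ?q ^ fvec.dim ?S"
    by (intro fvec.card_subspace fvec.subspace_sums sub) auto
  then have "?q ^ (fvec.dim ?S + fvec.dim (U \<inter> W)) = ?q ^ (k + k)"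
    using fvec.card_sums_Int[OF fin sub] int
      card_subspaces_of_dim(2)[OF assms(1)] card_subspaces_of_dim(2)[OF assms(2)]
    by (simp add: power_add)
  then have "fvec.dim ?S + fvec.dim (U \<inter> W) = k + k"
    using q by (subst (asm) power_inject_exp) auto
  then have "int (2 * \<delta>) \<le> subspace_dist U W \<longleftrightarrow> fvec.dim (U \<inter> W) + \<delta> \<le> k"
    unfolding subspace_dist_def by linarith
  also have "\<dots> \<longleftrightarrow> ?q ^ (fvec.dim (U \<inter> W) + \<delta>) \<le> ?q ^ k"
    using q by (subst power_increasing_iff) auto
  finally show ?thesis
    by (simp add: int power_add)
qed

lemma constant_dim_code_iff:
  fixes C :: "(nat \<Rightarrow> 'a::{finite,field}) set set"
  shows "constant_dim_code v (2 * \<delta>) k C \<longleftrightarrow> C \<subseteq> subspaces_of_dim v k \<and>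
    (\<forall>U\<in>C. \<forall>W\<in>C. U \<noteq> W \<longrightarrow> card (U \<inter> W) * CARD('a) ^ \<delta> \<le> CARD('a) ^ k)"
proof (cases "C \<subseteq> subspaces_of_dim v k")
  case True
  then have "int (2 * \<delta>) \<le> subspace_dist U W \<longleftrightarrow> card (U \<inter> W) * CARD('a) ^ \<delta> \<le> CARD('a) ^ k"
    if "U \<in> C" "W \<in> C" for U W
    using that by (intro subspace_dist_ge_iff) auto
  with True show ?thesis
    by (simp only: constant_dim_code_def pairwise_def) blast
qed (simp add: constant_dim_code_def)

text \<open>The map \<open>p\<close> is a projection onto \<open>W\<close>. Splitting
  \<open>x\<close> as \<open>(x - p x) + p x\<close> shows that the kernel inside the coordinate
  space has \<open>q ^ m\<close> elements.\<close>

lemma complement_of_subspace: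
  fixes W :: "(nat \<Rightarrow> 'a::{finite,field}) set"
  assumes "W \<in> subspaces_of_dim (m + n) n"
  obtains p where "Vector_Spaces.linear scale_fun scale_fun p" "\<And>w. w \<in> W \<Longrightarrow> p w = w"
    "{x \<in> coord_space (m + n). p x = 0} \<in> subspaces_of_dim (m + n) m"
proof -
  have W: "fvec.subspace W" "W \<subseteq> coord_space (m + n)"
    using assms by (auto simp: subspaces_of_dim_def)
  \<comment> \<open>A linear left inverse of the identity on \<open>W\<close> with range in
    \<open>W\<close> is such a projection.\<close>
  obtain p where p: "range p \<subseteq> W" "Vector_Spaces.linear scale_fun scale_fun p" "\<forall>w\<in>W. p w = w"
    using fvec_fvec.linear_exists_left_inverse_on[OF fvec.linear_id W(1)] by auto
  interpret p: Vector_Spaces.linear scale_fun scale_fun p by fact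
  let ?Z = "{x \<in> coord_space (m + n). p x = 0}"
  have "bij_betw (\<lambda>(z, w). z + w) (?Z \<times> W) (coord_space (m + n))"
  proof (rule bij_betwI[where g = "\<lambda>x. (x - p x, p x)"])
    show "(\<lambda>(z, w). z + w) \<in> ?Z \<times> W \<rightarrow> coord_space (m + n)"
      using W(2) by (auto intro: fvec.subspace_add[OF subspace_coord_space])
    have "p x \<in> W" "p (p x) = p x" for x
      using p by auto
    then show "(\<lambda>x. (x - p x, p x)) \<in> coord_space (m + n) \<rightarrow> ?Z \<times> W"
      using W(2) by (auto simp: p.diff intro!: fvec.subspace_diff[OF subspace_coord_space])
  qed (use p in \<open>auto simp: p.add\<close>)
  then have "card (?Z \<times> W) = card (coord_space (m + n) :: (nat \<Rightarrow> 'a) set)"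
    by (rule bij_betw_same_card)
  then have "card ?Z * CARD('a) ^ n = CARD('a) ^ m * CARD('a) ^ n"
    using card_subspaces_of_dim(2)[OF assms]
    by (simp add: card_cartesian_product card_coord_space power_add)
  then have "card ?Z = CARD('a) ^ m"
    by simp
  moreover have "fvec.subspace ?Z"
    using subspace_coord_space[of "m + n"]
    by (auto simp: fvec.subspace_def p.add p.scale)
  ultimately have "?Z \<in> subspaces_of_dim (m + n) m"
    by (intro subspaces_of_dimI) auto
  then show thesis
    using that p by blast
qed

text \<open>The new code is the union of \<open>D\<close> with all graphs. The hypothesis
  \<open>k \<le> n\<close> lets every codeword of \<open>C\<close> be identified with a subspace of
  the domain \<open>coord_space n\<close> of the Gabidulin maps.\<close>

lemma constant_dim_code_lifting:
  fixes C D :: "(nat \<Rightarrow> 'a::{finite,field}) set set"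
  assumes "k \<le> n" "1 \<le> \<delta>" "\<delta> \<le> k"
    and C: "constant_dim_code m (2 * \<delta>) k C"
    and D: "constant_dim_code (m + n) (2 * \<delta>) k D"
    and W: "W \<in> subspaces_of_dim (m + n) n" "\<And>U. U \<in> D \<Longrightarrow> \<delta> \<le> fvec.dim (U \<inter> W)"
  shows "\<exists>K :: (nat \<Rightarrow> 'a) set set. constant_dim_code (m + n) (2 * \<delta>) k K \<and>
    card K = card C * CARD('a) ^ (n * (k - \<delta> + 1)) + card D"
proof -
  let ?q = "CARD('a)" and ?V = "\<lambda>n. coord_space n :: (nat \<Rightarrow> 'a) set"
  have q: "1 < ?q"
    using CARD_field_ge_2[where 'a = 'a] by simp
  have CD: "C \<subseteq> subspaces_of_dim m k" "D \<subseteq> subspaces_of_dim (m + n) k"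
    using C D by (auto simp: constant_dim_code_def)
  have Wsub: "fvec.subspace W" "fvec.dim W = n" "W \<subseteq> ?V (m + n)"
    using W(1) by (auto simp: subspaces_of_dim_def)
  obtain p where p: "Vector_Spaces.linear scale_fun scale_fun p" "\<And>w. w \<in> W \<Longrightarrow> p w = w"
    and Z: "{x \<in> ?V (m + n). p x = 0} \<in> subspaces_of_dim (m + n) m"
    using complement_of_subspace[OF W(1)] by blast
  interpret p: Vector_Spaces.linear scale_fun scale_fun p by fact
  \<comment> \<open>\<open>T\<close> moves the ambient space of \<open>C\<close> onto the complement
    of \<open>W\<close>; \<open>S\<close> below moves the codomain of the Gabidulin maps onto
    \<open>W\<close>.\<close>
  obtain T where T: "Vector_Spaces.linear scale_fun scale_fun T" "inj_on T (?V m)"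
    "T ` ?V m = {x \<in> ?V (m + n). p x = 0}"
    using fvec_fvec.finite_subspaces_isomorphism[OF finite_coord_space card_subspaces_of_dim(1)[OF Z]
      subspace_coord_space] Z by (auto simp: subspaces_of_dim_def dim_coord_space)
  obtain S where S: "Vector_Spaces.linear scale_fun scale_fun S" "inj_on S (?V n)" "S ` ?V n = W"
    using fvec_fvec.finite_subspaces_isomorphism[OF finite_coord_space card_subspaces_of_dim(1)[OF W(1)]
      subspace_coord_space] Wsub by (auto simp: dim_coord_space)
  interpret T: Vector_Spaces.linear scale_fun scale_fun T by fact
  \<comment> \<open>Coordinates on each codeword, through which maps on \<open>?V n\<close> restrict
    to \<open>U\<close>.\<close>
  have "\<exists>t. Vector_Spaces.linear scale_fun scale_fun t \<and> inj_on t U \<and> t ` U = ?V k" if "U \<in> C" for U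
  proof -
    have U: "U \<in> subspaces_of_dim m k" using that CD by auto
    then have "fvec.subspace U" "fvec.dim U = fvec.dim (?V k)"
      by (auto simp: subspaces_of_dim_def dim_coord_space)
    then show ?thesis
      using fvec_fvec.finite_subspaces_isomorphism[OF card_subspaces_of_dim(1)[OF U] finite_coord_space
        _ subspace_coord_space] by metis
  qed
  then obtain \<tau> where \<tau>: "\<And>U. U \<in> C \<Longrightarrow> Vector_Spaces.linear scale_fun scale_fun (\<tau> U)"
    "\<And>U. U \<in> C \<Longrightarrow> inj_on (\<tau> U) U" "\<And>U. U \<in> C \<Longrightarrow> \<tau> U ` U = ?V k"
    by metis
  have "k - \<delta> < n" using assms by simp
  then obtain \<Phi> :: "((nat \<Rightarrow> 'a) \<Rightarrow> nat \<Rightarrow> 'a) set"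
    where \<Phi>: "finite \<Phi>" "card \<Phi> = ?q ^ (n * (k - \<delta> + 1))"
      "\<And>f. f \<in> \<Phi> \<Longrightarrow> Vector_Spaces.linear scale_fun scale_fun f"
      "\<And>f. f \<in> \<Phi> \<Longrightarrow> f ` ?V n \<subseteq> ?V n"
      "\<And>f g. f \<in> \<Phi> \<Longrightarrow> g \<in> \<Phi> \<Longrightarrow> f \<noteq> g \<Longrightarrow> card {x \<in> ?V n. f x = g x} \<le> ?q ^ (k - \<delta>)"
    by (rule gabidulin_code[where 'a = 'a]) blast

  \<comment> \<open>The point over \<open>u\<close> on the graph of \<open>f\<close> restricted to
    \<open>U\<close>: one summand in the complement, one in \<open>W\<close>.\<close>
  define h where "h U f u = T u + S (f (\<tau> U u))" for U f u
  define G where "G U f = h U f ` U" for U f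
  have h_linear: "Vector_Spaces.linear scale_fun scale_fun (h U f)" if "U \<in> C" "f \<in> \<Phi>" for U f
    using T(1) S(1) \<tau>(1)[OF that(1)] \<Phi>(3)[OF that(2)]
    by (simp add: Vector_Spaces.linear_iff h_def fvec.scale_right_distrib add_ac)
  have Vkn: "?V k \<subseteq> ?V n"
    using \<open>k \<le> n\<close> by (auto simp: coord_space_def)
  have UV: "U \<subseteq> ?V m" if "U \<in> C" for U
    using that CD by (auto simp: subspaces_of_dim_def)
  have f\<tau>: "f (\<tau> U u) \<in> ?V n" "\<tau> U u \<in> ?V n" if "U \<in> C" "f \<in> \<Phi>" "u \<in> U" for U f u
    using that \<tau>(3) \<Phi>(4) Vkn by blast+
  have pT: "T u \<in> ?V (m + n)" "p (T u) = 0" if "u \<in> ?V m" for u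
    using T(3) that by auto
  have SW: "S w \<in> W" if "w \<in> ?V n" for w
    using S(3) that by auto
  \<comment> \<open>The projection \<open>p\<close> kills the first summand and fixes the second, so
    both are determined by the point; then \<open>T\<close> and \<open>S\<close> are
    cancelled.\<close>
  have h_eq: "u = u' \<and> f (\<tau> U u) = f' (\<tau> U' u')"
    if "U \<in> C" "f \<in> \<Phi>" "u \<in> U" "U' \<in> C" "f' \<in> \<Phi>" "u' \<in> U'" "h U f u = h U' f' u'" for U f u U' f' u'
  proof -
    note f\<tau> = f\<tau>(1)[OF that(1-3)] f\<tau>(1)[OF that(4-6)]
    have u: "u \<in> ?V m" "u' \<in> ?V m" using UV that by auto
    have "p (h U f u) = p (h U' f' u')" using that by simp
    then have "S (f (\<tau> U u)) = S (f' (\<tau> U' u'))"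
      using u f\<tau> by (simp add: h_def p.add pT SW p(2))
    moreover from this have "T u = T u'"
      using that(7) by (simp add: h_def)
    ultimately show ?thesis
      using u f\<tau> T(2) S(2) by (meson inj_onD)
  qed
  have h_inj: "inj_on (h U f) U" if "U \<in> C" "f \<in> \<Phi>" for U f
    using h_eq that by (intro inj_onI) blast
  have G_dim: "G U f \<in> subspaces_of_dim (m + n) k" if "U \<in> C" "f \<in> \<Phi>" for U f
  proof (rule subspaces_of_dimI)
    have U: "U \<in> subspaces_of_dim m k" using that CD by auto
    then show "fvec.subspace (G U f)"
      unfolding G_def by (intro fvec_fvec.linear_subspace_image h_linear that)
        (auto simp: subspaces_of_dim_def)
    show "card (G U f) = ?q ^ k"
      unfolding G_def using h_inj that card_subspaces_of_dim(2)[OF U] by (simp add: card_image)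
    have "h U f u \<in> ?V (m + n)" if "u \<in> U" for u
      unfolding h_def using UV[OF \<open>U \<in> C\<close>] that SW f\<tau>(1)[OF \<open>U \<in> C\<close> \<open>f \<in> \<Phi>\<close>] Wsub(3)
      by (intro fvec.subspace_add[OF subspace_coord_space] pT) auto
    then show "G U f \<subseteq> ?V (m + n)"
      by (auto simp: G_def)
  qed
  have GG: "card (G U f \<inter> G U' f') * ?q ^ \<delta> \<le> ?q ^ k"
    if "U \<in> C" "f \<in> \<Phi>" "U' \<in> C" "f' \<in> \<Phi>" "(U, f) \<noteq> (U', f')" for U f U' f'
  proof (cases "U = U'")
    case False
    have U: "U \<in> subspaces_of_dim m k" "U' \<in> subspaces_of_dim m k" using that CD by auto
    \<comment> \<open>Common points lie over common vectors of the two codewords, whatever the maps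
      are.\<close>
    have "G U f \<inter> G U' f' \<subseteq> h U f ` (U \<inter> U')"
    proof
      fix x assume "x \<in> G U f \<inter> G U' f'"
      then obtain u u' where u: "u \<in> U" "u' \<in> U'" "x = h U f u" "h U f u = h U' f' u'"
        by (auto simp: G_def)
      then have "u = u'"
        using h_eq that by blast
      then show "x \<in> h U f ` (U \<inter> U')"
        using u by (metis IntI imageI)
    qed
    then have "card (G U f \<inter> G U' f') \<le> card (U \<inter> U')"
      using card_subspaces_of_dim(1)[OF U(1)] by (intro surj_card_le) auto
    moreover have "card (U \<inter> U') * ?q ^ \<delta> \<le> ?q ^ k"
      using C False that(1,3) by (simp add: constant_dim_code_iff)
    ultimately show ?thesis
      by (meson le_trans mult_le_mono1)
  next
    case True
    let ?A = "{x \<in> ?V n. f x = f' x}"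
    \<comment> \<open>Over one codeword, common points lie where the two maps agree.\<close>
    have "G U f \<inter> G U' f' \<subseteq> h U f ` {u \<in> U. \<tau> U u \<in> ?A}"
    proof
      fix x assume "x \<in> G U f \<inter> G U' f'"
      then obtain u u' where u: "u \<in> U" "u' \<in> U" "x = h U f u" "h U f u = h U f' u'"
        using True by (auto simp: G_def)
      then have "u = u' \<and> f (\<tau> U u) = f' (\<tau> U u')"
        using h_eq that True by blast
      then show "x \<in> h U f ` {u \<in> U. \<tau> U u \<in> ?A}"
        using u f\<tau>(2)[OF that(1,2)] by (intro image_eqI[of _ _ u]) auto
    qed
    moreover have U: "finite U"
      using that CD card_subspaces_of_dim(1) by blast
    ultimately have "card (G U f \<inter> G U' f') \<le> card {u \<in> U. \<tau> U u \<in> ?A}"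
      by (intro surj_card_le) auto
    also have "\<dots> \<le> card ?A"
      using \<tau>(2)[OF that(1)] finite_coord_space[of n, where 'a = 'a]
      by (intro card_inj_on_le[of "\<tau> U"]) (auto intro: inj_on_subset)
    also have "\<dots> \<le> ?q ^ (k - \<delta>)"
      using \<Phi>(5) that True by auto
    finally have "card (G U f \<inter> G U' f') * ?q ^ \<delta> \<le> ?q ^ (k - \<delta>) * ?q ^ \<delta>"
      by simp
    then show ?thesis
      using \<open>\<delta> \<le> k\<close> by (simp flip: power_add)
  qed
  \<comment> \<open>From \<open>p x = x\<close> the complement part \<open>T u\<close> vanishes,
    hence so do \<open>u\<close> and \<open>x\<close>.\<close>
  have GW: "x = 0" if "U \<in> C" "f \<in> \<Phi>" "x \<in> G U f" "x \<in> W" for U f x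
  proof -
    from that(3) obtain u where u: "u \<in> U" "x = T u + S (f (\<tau> U u))"
      by (auto simp: G_def h_def)
    have um: "u \<in> ?V m" using u UV that by auto
    have "p x = S (f (\<tau> U u))"
      using u um f\<tau>(1)[OF that(1,2) u(1)] by (simp add: p.add pT SW p(2))
    then have "T u = 0"
      using u p(2)[OF that(4)] by simp
    moreover have "(0 :: nat \<Rightarrow> 'a) \<in> ?V m"
      by (rule fvec.subspace_0[OF subspace_coord_space])
    ultimately have "u = 0"
      using inj_onD[OF T(2), of u 0] um by (simp add: T.zero)
    then have "x = h U f 0"
      using u by (simp add: h_def)
    then show "x = 0"
      using fvec_fvec.linear_0[OF h_linear[OF that(1,2)]] by simp
  qed
  have GD: "card (G U f \<inter> M) * ?q ^ \<delta> \<le> ?q ^ k" if "U \<in> C" "f \<in> \<Phi>" "M \<in> D" for U f M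
  proof -
    have M: "M \<in> subspaces_of_dim (m + n) k" using that CD by auto
    note Xf = card_subspaces_of_dim[OF M]
    have sub: "fvec.subspace M" "fvec.subspace (G U f)"
      using M G_dim[OF that(1,2)] by (auto simp: subspaces_of_dim_def)
    have "?q ^ \<delta> \<le> ?q ^ fvec.dim (M \<inter> W)"
      using W(2)[OF that(3)] q by (simp add: power_increasing)
    also have "\<dots> = card (M \<inter> W)"
      using Xf(1) by (intro fvec.card_subspace[symmetric] fvec.subspace_inter sub Wsub) auto
    finally have "card (G U f \<inter> M) * ?q ^ \<delta> \<le> card ((G U f \<inter> M) \<times> (M \<inter> W))"
      by (simp add: card_cartesian_product)
    \<comment> \<open>Inside \<open>M\<close> the subspaces \<open>G U f \<inter> M\<close> and
      \<open>M \<inter> W\<close> meet only in 0, so addition is injective on their product.\<close>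
    also have "\<dots> \<le> card M"
    proof (rule card_inj_on_le[of "\<lambda>(x, y). x + y"])
      show "(\<lambda>(x, y). x + y) ` ((G U f \<inter> M) \<times> (M \<inter> W)) \<subseteq> M"
        using sub by (auto intro: fvec.subspace_add)
      show "inj_on (\<lambda>(x, y). x + y) ((G U f \<inter> M) \<times> (M \<inter> W))"
      proof (rule inj_onI, clarify)
        fix x y x' y' assume *: "x \<in> G U f" "x' \<in> G U f" "y \<in> W" "y' \<in> W" "x + y = x' + y'"
        have "x - x' = y' - y"
          using *(5) by (simp add: algebra_simps)
        moreover have "x - x' \<in> G U f" "y' - y \<in> W"
          using * sub Wsub by (auto intro: fvec.subspace_diff)
        ultimately have "x - x' = 0"
          using GW[OF that(1,2)] by metis
        then show "x = x' \<and> y = y'"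
          using * by simp
      qed
    qed (rule Xf)
    finally show ?thesis by (simp add: Xf)
  qed

  \<comment> \<open>A codeword meets itself in \<open>q ^ k\<close> points, so \<open>GG\<close> and
    \<open>GD\<close> also exclude coincidences: distinct pairs give distinct graphs, and no graph
    belongs to \<open>D\<close>.\<close>
  have qk: "\<not> ?q ^ k * ?q ^ \<delta> \<le> ?q ^ k"
    using q \<open>1 \<le> \<delta>\<close> one_less_power[OF q, of \<delta>] by (simp add: not_le)
  define L where "L = (\<lambda>(U, f). G U f) ` (C \<times> \<Phi>)"
  have "inj_on (\<lambda>(U, f). G U f) (C \<times> \<Phi>)"
  proof (rule inj_onI, clarify)
    fix U f U' f' assume *: "U \<in> C" "f \<in> \<Phi>" "U' \<in> C" "f' \<in> \<Phi>" "G U f = G U' f'"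
    show "U = U' \<and> f = f'"
      using GG[OF *(1-4)] *(5) qk card_subspaces_of_dim(2)[OF G_dim[OF *(1,2)]] by auto
  qed
  then have "card L = card C * ?q ^ (n * (k - \<delta> + 1))"
    unfolding L_def by (simp add: card_image card_cartesian_product \<Phi>(2))
  moreover have "L \<inter> D = {}"
  proof -
    have False if "U \<in> C" "f \<in> \<Phi>" "G U f \<in> D" for U f
      using GD[OF that] qk card_subspaces_of_dim(2)[OF G_dim[OF that(1,2)]] by simp
    then show ?thesis by (auto simp: L_def)
  qed
  moreover have "finite L" "finite D"
  proof -
    have fin: "finite (subspaces_of_dim v k :: (nat \<Rightarrow> 'a) set set)" for v
      by (rule finite_subset[of _ "Pow (coord_space v)"])
        (auto simp: subspaces_of_dim_def finite_coord_space)
    show "finite D"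
      using fin CD finite_subset by blast
    show "finite L"
      unfolding L_def using finite_subset[OF CD(1) fin] \<Phi>(1) by simp
  qed
  ultimately have "card (L \<union> D) = card C * ?q ^ (n * (k - \<delta> + 1)) + card D"
    by (simp add: card_Un_disjoint)
  moreover have "constant_dim_code (m + n) (2 * \<delta>) k (L \<union> D)"
    unfolding constant_dim_code_iff
  proof (intro conjI ballI impI)
    show "L \<union> D \<subseteq> subspaces_of_dim (m + n) k"
      using CD G_dim by (auto simp: L_def)
    show "card (M \<inter> M') * ?q ^ \<delta> \<le> ?q ^ k" if "M \<in> L \<union> D" "M' \<in> L \<union> D" "M \<noteq> M'" for M M'
    proof (cases "M \<in> D \<and> M' \<in> D")
      case True
      then show ?thesis
        using D that(3) by (simp add: constant_dim_code_iff)
    next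
      case False
      then show ?thesis
        using that GG GD by (auto simp: L_def Int_commute)
    qed
  qed
  ultimately show ?thesis by blast
qed

section \<open>The bound for maximal codes\<close>

theorem theorem3:
  fixes F :: "'a::{finite,field} itself" and q v k d m :: nat
  assumes "CARD('a) = q"
    and "2 \<le> k" and "k \<le> v"
    and "even d" and "2 \<le> d" and "d \<le> 2 * k"
    and "k \<le> m" and "m \<le> v - k"
  shows "int (A_max F v d k) \<ge>
    int (A_max F m d k)
      * \<lceil>real q powr ((real v - real m) * (real k - real d / 2 + 1))\<rceil>
    + int (B_max F v (v - m) d k)"
proof -
  obtain \<delta> where d: "d = 2 * \<delta>"
    using \<open>even d\<close> by blast
  define n where "n = v - m"
  have v: "v = m + n" and n: "k \<le> n" and \<delta>: "1 \<le> \<delta>" "\<delta> \<le> k"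
    using assms d by (auto simp: n_def)
  have fin: "finite {card C |C :: (nat \<Rightarrow> 'a) set set. constant_dim_code v d k C \<and> P C}" for v P
    using finite_constant_dim_codes[of v d k, where 'a = 'a] by simp
  have finA: "finite {card C |C :: (nat \<Rightarrow> 'a) set set. constant_dim_code v d k C}" for v
    using fin[of v "\<lambda>_. True"] by simp
  have empty: "constant_dim_code v d k ({} :: (nat \<Rightarrow> 'a) set set)" for v
    by (simp add: constant_dim_code_def)
  have "A_max F m d k \<in> {card C |C :: (nat \<Rightarrow> 'a) set set. constant_dim_code m d k C}"
    unfolding A_max_def using empty by (intro Max_in finA) blast
  then obtain C :: "(nat \<Rightarrow> 'a) set set" where C: "constant_dim_code m d k C" "A_max F m d k = card C"
    by blast
  \<comment> \<open>The maximum is attained because the set is nonempty: the empty code qualifies,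
    with \<open>coord_space n\<close> as \<open>W\<close>.\<close>
  have "B_max F v n d k \<in> {card C |C :: (nat \<Rightarrow> 'a) set set. constant_dim_code v d k C \<and>
      (\<exists>W \<in> subspaces_of_dim v n. \<forall>U\<in>C. real d / 2 \<le> real (fvec.dim (U \<inter> W)))}"
    unfolding B_max_def using empty[of v] coord_space_in_subspaces_of_dim[of n v, where 'a = 'a] v
    by (intro Max_in fin) auto
  then obtain D :: "(nat \<Rightarrow> 'a) set set" and W where D: "constant_dim_code v d k D" "B_max F v n d k = card D"
    "W \<in> subspaces_of_dim v n" "\<forall>U\<in>D. real d / 2 \<le> real (fvec.dim (U \<inter> W))"
    by blast
  then obtain K :: "(nat \<Rightarrow> 'a) set set" where K: "constant_dim_code v d k K"
    "card K = card C * q ^ (n * (k - \<delta> + 1)) + card D"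
    using constant_dim_code_lifting[OF n \<delta>, of m C D W] C assms(1) v d by auto
  have "card K \<le> A_max F v d k"
    unfolding A_max_def using K(1) by (intro Max_ge finA) blast
  \<comment> \<open>As \<open>d\<close> is even, the exponent is a natural number, so the ceiling is
    taken of an integer.\<close>
  moreover have "(real v - real m) * (real k - real d / 2 + 1) = real (n * (k - \<delta> + 1))"
    using v d \<delta> by (simp add: of_nat_diff distrib_left)
  then have "real q powr ((real v - real m) * (real k - real d / 2 + 1)) = real (q ^ (n * (k - \<delta> + 1)))"
    using CARD_field_ge_2[where 'a = 'a] assms(1) by (simp only: powr_realpow of_nat_power)
  then have "\<lceil>real q powr ((real v - real m) * (real k - real d / 2 + 1))\<rceil> = int (q ^ (n * (k - \<delta> + 1)))"
    by (simp only: ceiling_of_nat)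
  ultimately show ?thesis
    using K(2) C(2) D(2) by (simp only: n_def flip: of_nat_mult of_nat_add)
qed

end
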